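(* For every integer $n\ge1$, $$a_n(x)=\frac{1}{x}\left(\frac{\sqrt{4x-1}}{2}\right)^{n+1}P_n\!\left(\frac{1}{\sqrt{4x-1}}\right),\qquad b_n(x)=(4x-1)^{\frac n2}\,Q_n\!\left(\frac{1}{\sqrt{4x-1}}\right).$$
   Context: Derivative polynomials: $P_0(u)=u$, $P_{n+1}(u)=(1+u^2)P_n'(u)$; $Q_0(u)=1$, $Q_{n+1}(u)=(1+u^2)Q_n'(u)+uQ_n(u)$. Equivalently, with $D=d/dx$, $D^n(\tan x)=P_n(\tan x)$ and $D^n(\sec x)=\sec x\cdot Q_n(\tan x)$. $a_n(x)=\sum_{k\ge0}a(n,k)x^k$ and $b_n(x)=\sum_{k\ge0}b(n,k)x^k$, where the numbers $a(n,k)$, $b(n,k)$ are as follows (and are $0$ outside the ranges indicated). For a permutation $\pi$ of $\{1,\dots,n\}$ let $\mathrm{des}(\pi)=\#\{1\le i\le n-1:\pi(i)>\pi(i+1)\}$ and $A_n(x)=\sum_{\pi\in\mathfrak S_n}x^{\mathrm{des}(\pi)}$. For $n\ge1$, the $a(n,k)$ are the uniquely determined coefficients in $A_n(x)=\sum_{k=0}^{\lfloor (n-1)/2\rfloor}a(n,k)x^k(1+x)^{n-1-2k}$ (such an expansion exists). Let $B_n$ be the group of signed permutations, i.e. bijections $\pi$ of $\{\pm1,\dots,\pm n\}$ with $\pi(-i)=-\pi(i)$; put $\pi(0)=0$, $\mathrm{des}_B(\pi)=\#\{i\in\{0,1,\dots,n-1\}:\pi(i)>\pi(i+1)\}$ and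 $B_n(x)=\sum_{\pi\in B_n}x^{\mathrm{des}_B(\pi)}$. For $n\ge1$, the $b(n,k)$ are the uniquely determined coefficients in $B_n(x)=\sum_{k=0}^{\lfloor n/2\rfloor}b(n,k)x^k(1+x)^{n-2k}$ (such an expansion exists). The identities are understood for $x\notin\{0,1/4\}$ (complex $x$), where $\sqrt{4x-1}$ is one fixed square root, the same at each occurrence, and $(4x-1)^{n/2}=(\sqrt{4x-1})^n$. *)

theory Defs
  imports Complex_Main "HOL-Combinatorics.Permutations" "HOL-Computational_Algebra.Polynomial"
begin

fun deriv_P :: "nat \<Rightarrow> complex poly" where
  "deriv_P 0 = [:0, 1:]"
| "deriv_P (Suc n) = [:1, 0, 1:] * pderiv (deriv_P n)"

fun deriv_Q :: "nat \<Rightarrow> complex poly" where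
  "deriv_Q 0 = 1"
| "deriv_Q (Suc n) = [:1, 0, 1:] * pderiv (deriv_Q n) + [:0, 1:] * deriv_Q n"

definition des :: "nat \<Rightarrow> (nat \<Rightarrow> nat) \<Rightarrow> nat" where
  "des n \<pi> = card {i \<in> {1..<n}. \<pi> i > \<pi> (i + 1)}"

definition eulerian_A :: "nat \<Rightarrow> int poly" where
  "eulerian_A n = (\<Sum>\<pi> | \<pi> permutes {1..n}. monom 1 (des n \<pi>))"

(* By the convention of permutes, a signed permutation is extended by the identity
   outside its domain; in particular it maps 0 to 0, as des_B requires. *)
definition signed_perms :: "nat \<Rightarrow> (int \<Rightarrow> int) set" where
  "signed_perms n = {\<pi>. \<pi> permutes ({- int n..int n} - {0}) \<and>
     (\<forall>i \<in> {- int n..int n} - {0}. \<pi> (- i) = - \<pi> i)}"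

definition des_B :: "nat \<Rightarrow> (int \<Rightarrow> int) \<Rightarrow> nat" where
  "des_B n \<pi> = card {i \<in> {0..<int n}. \<pi> i > \<pi> (i + 1)}"

definition eulerian_B :: "nat \<Rightarrow> int poly" where
  "eulerian_B n = (\<Sum>\<pi> \<in> signed_perms n. monom 1 (des_B n \<pi>))"

(* The unique coefficients c with f = (SUM k <= d div 2. c k * x^k * (1 + x)^(d - 2k)),
   set to 0 beyond d div 2. Only meaningful if such an expansion of f exists. *)
definition gamma_coeffs :: "nat \<Rightarrow> int poly \<Rightarrow> nat \<Rightarrow> int" where
  "gamma_coeffs d f = (THE c. (\<forall>k > d div 2. c k = 0) \<and>
     f = (\<Sum>k\<le>d div 2. smult (c k) ([:0, 1:] ^ k * [:1, 1:] ^ (d - 2 * k))))"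

definition a_coeff :: "nat \<Rightarrow> nat \<Rightarrow> int" where
  "a_coeff n = gamma_coeffs (n - 1) (eulerian_A n)"

definition b_coeff :: "nat \<Rightarrow> nat \<Rightarrow> int" where
  "b_coeff n = gamma_coeffs n (eulerian_B n)"

definition a_fun :: "nat \<Rightarrow> complex \<Rightarrow> complex" where
  "a_fun n x = (\<Sum>k\<le>(n - 1) div 2. of_int (a_coeff n k) * x ^ k)"

definition b_fun :: "nat \<Rightarrow> complex \<Rightarrow> complex" where
  "b_fun n x = (\<Sum>k\<le>n div 2. of_int (b_coeff n k) * x ^ k)"

end

theory Submission
  imports Defs
begin

text \<open>
  Inserting the letter n + 1 (or, for signed permutations, n + 1 and -(n + 1)) into a word w of length
  n changes the number of descents of 0w by 0 or 1, and counting the positions of either kind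
  gives E(d + 1) = (1 + (rd + 1)x) E(d) + r x(1 - x) E(d)', where r = 1 and E(d) = A_(d + 1) in type A,
  and r = 2 and E(d) = B_d in type B. This operator sends x^k (1 + x)^(d - 2k) to
  (rk + 1) x^k (1 + x)^(d + 1 - 2k) + 2r(d - 2k) x^(k + 1) (1 + x)^(d - 1 - 2k), which yields a
  recurrence for the gamma coefficients. On the other side, substituting x = (1 + u^2) / (4u^2),
  u = 1/s, turns the claims into expansions of P and Q in the polynomials u^e (1 + u^2)^j, and the
  operators defining P and Q act on these by the same recurrence.
\<close>

section \<open>The common recurrence of the gamma coefficients\<close>

text \<open>Row \<open>d\<close> of the triangle a(d + 1, k) for \<open>r = 1\<close> and of b(d, k)
  for \<open>r = 2\<close>.\<close>

fun gamma_rec :: "int \<Rightarrow> nat \<Rightarrow> nat \<Rightarrow> int" where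
  "gamma_rec r 0 k = (if k = 0 then 1 else 0)"
| "gamma_rec r (Suc d) 0 = gamma_rec r d 0"
| "gamma_rec r (Suc d) (Suc k) =
     (r * int (Suc k) + 1) * gamma_rec r d (Suc k) + 2 * r * (int d - 2 * int k) * gamma_rec r d k"

text \<open>The induction hypothesis reaches every summand except the last one in the case
  \<open>d = 2 * k\<close>, and there the factor \<open>int d - 2 * int k\<close> vanishes.\<close>

lemma gamma_rec_eq_0: "d < 2 * k \<Longrightarrow> gamma_rec r d k = 0"
proof (induction r d k rule: gamma_rec.induct)
  case (3 r d k)
  then show ?case by (cases "d = 2 * k") auto
qed auto

definition gamma_sum :: "int \<Rightarrow> (nat \<Rightarrow> nat \<Rightarrow> 'a::idom poly) \<Rightarrow> nat \<Rightarrow> 'a poly" where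
  "gamma_sum r t d = (\<Sum>k\<le>d div 2. smult (of_int (gamma_rec r d k)) (t d k))"

lemma gamma_sum_extend:
  "d div 2 \<le> N \<Longrightarrow> gamma_sum r t d = (\<Sum>k\<le>N. smult (of_int (gamma_rec r d k)) (t d k))"
  unfolding gamma_sum_def
  by (rule sum.mono_neutral_left) (auto simp: gamma_rec_eq_0)

text \<open>The operator sends the k-th basis element to a combination of the k-th and (k + 1)-st
  elements of the next row, so comparing coefficients gives the recurrence of
  \<open>gamma_rec\<close>. It serves both sides of the theorem: \<open>gamma_basis\<close> on one,
  \<open>P_basis\<close> and \<open>Q_basis\<close> on the other.\<close>

lemma gamma_sum_step:
  fixes t :: "nat \<Rightarrow> nat \<Rightarrow> 'a::idom poly" and L :: "'a poly \<Rightarrow> 'a poly"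
  assumes add: "\<And>p q. L (p + q) = L p + L q"
    and smult: "\<And>c p. L (smult c p) = smult c (L p)"
    and step: "\<And>k. 2 * k \<le> d \<Longrightarrow> L (t d k) =
      smult (of_int (r * int k + 1)) (t (Suc d) k)
      + smult (of_int (2 * r * (int d - 2 * int k))) (t (Suc d) (Suc k))"
  shows "L (gamma_sum r t d) = gamma_sum r t (Suc d)"
proof -
  let ?g = "\<lambda>k. of_int (gamma_rec r d k) :: 'a"
  let ?u = "\<lambda>k. smult (?g k * of_int (r * int k + 1)) (t (Suc d) k)"
  let ?v = "\<lambda>k. smult (?g k * of_int (2 * r * (int d - 2 * int k))) (t (Suc d) (Suc k))"
  have L0: "L 0 = 0" using smult[of 0 0] by simp
  have Lsum: "L (sum f A) = (\<Sum>k\<in>A. L (f k))" if "finite A" for f and A :: "nat set"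
    using that by (induction A rule: finite_induct) (auto simp: L0 add)
  \<comment> \<open>The range is enlarged to k <= d so that the index shift below needs no case
    distinction on the parity of \<open>d\<close>.\<close>
  have "L (gamma_sum r t d) = (\<Sum>k\<le>d. smult (?g k) (L (t d k)))"
    by (subst gamma_sum_extend[of d d]) (auto simp: Lsum smult)
  also have "\<dots> = (\<Sum>k\<le>d. ?u k + ?v k)"
  proof (rule sum.cong[OF refl])
    fix k
    show "smult (?g k) (L (t d k)) = ?u k + ?v k"
    proof (cases "2 * k \<le> d")
      case True
      then show ?thesis by (simp add: step smult_add_right del: of_int_add of_int_mult of_int_diff)
    qed (simp add: gamma_rec_eq_0)
  qed
  also have "\<dots> = (\<Sum>k\<le>d. ?u k) + (\<Sum>k\<le>d. ?v k)"
    by (rule sum.distrib)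
  \<comment> \<open>The added term is zero. Splitting off k = 0 then aligns
    \<open>?u (Suc k)\<close> with \<open>?v k\<close>, both multiples of
    \<open>t (Suc d) (Suc k)\<close>.\<close>
  also have "(\<Sum>k\<le>d. ?u k) = (\<Sum>k\<le>Suc d. ?u k)"
    by (simp add: gamma_rec_eq_0)
  also have "\<dots> = ?u 0 + (\<Sum>k\<le>d. ?u (Suc k))"
    by (rule sum.atMost_Suc_shift)
  finally have "L (gamma_sum r t d) = ?u 0 + (\<Sum>k\<le>d. ?u (Suc k) + ?v k)"
    by (simp add: sum.distrib add.assoc)
  also have "\<dots> = (\<Sum>k\<le>Suc d. smult (of_int (gamma_rec r (Suc d) k)) (t (Suc d) k))"
    by (subst sum.atMost_Suc_shift)
       (auto simp: smult_add_left[symmetric] algebra_simps intro!: sum.cong)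
  also have "\<dots> = gamma_sum r t (Suc d)"
    by (rule gamma_sum_extend[symmetric]) auto
  finally show ?thesis .
qed

lemma gamma_sum_0 [simp]: "gamma_sum r t 0 = t 0 0"
  by (simp add: gamma_sum_def)

section \<open>The insertion operator and the gamma basis\<close>

definition gamma_basis :: "nat \<Rightarrow> nat \<Rightarrow> int poly" where
  "gamma_basis d k = [:0, 1:] ^ k * [:1, 1:] ^ (d - 2 * k)"

text \<open>\<open>d\<close> is an integer because in type A the step from the empty word to length
  1 takes \<open>d = -1\<close>.\<close>

definition euler_op :: "int \<Rightarrow> int \<Rightarrow> int poly \<Rightarrow> int poly" where
  "euler_op r d p = [:1, r * d + 1:] * p + smult r ([:0, 1, -1:] * pderiv p)"

lemma euler_op_add: "euler_op r d (p + q) = euler_op r d p + euler_op r d q"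
  by (simp add: euler_op_def pderiv_add distrib_left smult_add_right del: mult_pCons_left)

lemma euler_op_smult: "euler_op r d (smult c p) = smult c (euler_op r d p)"
  by (simp add: euler_op_def pderiv_smult smult_add_right mult.commute del: mult_pCons_left mult_pCons_right)

lemma euler_op_sum: "euler_op r d (\<Sum>x\<in>A. f x) = (\<Sum>x\<in>A. euler_op r d (f x))"
proof (induction A rule: infinite_finite_induct)
qed (auto simp: euler_op_add, auto simp: euler_op_def)

lemma poly_pderiv_power:
  "poly (pderiv (p ^ k)) x = of_nat k * poly p x ^ (k - 1) * poly (pderiv p) x"
  for p :: "'a::idom poly"
  by (simp add: pderiv_power)

lemma poly_pderiv_mult:
  "poly (pderiv (p * q)) x = poly p x * poly (pderiv q) x + poly q x * poly (pderiv p) x"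
  by (simp add: pderiv_mult)

lemmas poly_pderiv_simps = poly_pderiv_mult poly_pderiv_power pderiv_smult pderiv_pCons pderiv_0
  poly_mult poly_power poly_smult poly_add poly_pCons poly_0

text \<open>With e = d - 2k, multiplying by (1 + x) / (x^k (1 + x)^e) reduces the claim to (1 + (rd
  + 1)x)(1 + x) + rk(1 - x)(1 + x) + re x(1 - x) = (rk + 1)(1 + x)^2 + 2re x.\<close>

lemma euler_op_gamma_basis:
  assumes "2 * k \<le> d"
  shows "euler_op r (int d) (gamma_basis d k) =
    smult (r * int k + 1) (gamma_basis (Suc d) k)
    + smult (2 * r * (int d - 2 * int k)) (gamma_basis (Suc d) (Suc k))"
proof -
  obtain e where e: "d = 2 * k + e" using assms le_Suc_ex by blast
  have "poly (euler_op r (int d) (gamma_basis d k)) x =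
    poly (smult (r * int k + 1) (gamma_basis (Suc d) k)
      + smult (2 * r * (int d - 2 * int k)) (gamma_basis (Suc d) (Suc k))) x" for x
    unfolding e euler_op_def gamma_basis_def poly_pderiv_simps
    \<comment> \<open>The splits resolve the truncated exponents k - 1 and e - 1; for e = 0 the
      second basis element is killed by its factor.\<close>
    by (cases k; cases e) (simp_all add: algebra_simps)
  then show ?thesis by (intro poly_eq_poly_eq_iff[THEN iffD1] ext)
qed

lemma coeff_gamma_basis:
  "coeff (gamma_basis d k) m = (if m < k then 0 else coeff ([:1, 1:] ^ (d - 2 * k)) (m - k))"
proof -
  have "gamma_basis d k = monom 1 k * [:1, 1:] ^ (d - 2 * k)"
    by (simp add: gamma_basis_def monom_altdef)
  then show ?thesis by (simp add: coeff_monom_mult)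
qed

text \<open>Triangularity: the lowest term of \<open>gamma_basis d k\<close> is x^k with coefficient
  1, so the coefficient of x^m determines \<open>c m\<close> from the earlier
  \<open>c k\<close>.\<close>

lemma gamma_basis_independent:
  assumes eq: "(\<Sum>k\<le>N. smult (c k) (gamma_basis d k)) = (\<Sum>k\<le>N. smult (c' k) (gamma_basis d k))"
    and "m \<le> N"
  shows "c m = c' m"
  using \<open>m \<le> N\<close>
proof (induction m rule: less_induct)
  case (less m)
  have split: "coeff (\<Sum>k\<le>N. smult (f k) (gamma_basis d k)) m =
      f m + (\<Sum>k<m. f k * coeff (gamma_basis d k) m)" for f
  proof -
    have "coeff (\<Sum>k\<le>N. smult (f k) (gamma_basis d k)) m =
        (\<Sum>k\<le>N. f k * coeff (gamma_basis d k) m)"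
      by (simp add: coeff_sum)
    also have "\<dots> = (\<Sum>k\<le>m. f k * coeff (gamma_basis d k) m)"
      using less.prems by (intro sum.mono_neutral_right) (auto simp: coeff_gamma_basis)
    also have "\<dots> = f m + (\<Sum>k<m. f k * coeff (gamma_basis d k) m)"
      by (simp add: coeff_gamma_basis coeff_0_power lessThan_Suc_atMost[symmetric])
    finally show ?thesis .
  qed
  have "(\<Sum>k<m. c k * coeff (gamma_basis d k) m) = (\<Sum>k<m. c' k * coeff (gamma_basis d k) m)"
    using less by (intro sum.cong) auto
  with arg_cong[OF eq, of "\<lambda>p. coeff p m"] show ?case
    by (simp add: split)
qed

text \<open>Provides the existence and uniqueness that the description in
  \<open>gamma_coeffs\<close> requires; beyond \<open>d div 2\<close> uniqueness is the convention
  that the coefficients are 0 there.\<close>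

lemma gamma_coeffs_gamma_sum: "gamma_coeffs d (gamma_sum r gamma_basis d) = gamma_rec r d"
  unfolding gamma_coeffs_def
proof (rule the_equality)
  show "(\<forall>k>d div 2. gamma_rec r d k = 0) \<and> gamma_sum r gamma_basis d =
      (\<Sum>k\<le>d div 2. smult (gamma_rec r d k) ([:0, 1:] ^ k * [:1, 1:] ^ (d - 2 * k)))"
    by (auto simp: gamma_rec_eq_0 gamma_sum_def gamma_basis_def)
next
  fix c
  assume c: "(\<forall>k>d div 2. c k = 0) \<and> gamma_sum r gamma_basis d =
      (\<Sum>k\<le>d div 2. smult (c k) ([:0, 1:] ^ k * [:1, 1:] ^ (d - 2 * k)))"
  then have "c k = gamma_rec r d k" if "k \<le> d div 2" for k
    using that gamma_basis_independent[where N = "d div 2" and d = d]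
    by (simp add: gamma_sum_def gamma_basis_def)
  moreover have "c k = gamma_rec r d k" if "\<not> k \<le> d div 2" for k
    using that c by (simp add: gamma_rec_eq_0)
  ultimately show "c = gamma_rec r d" by blast
qed

section \<open>Expansion of the derivative polynomials\<close>

text \<open>
  These are (2u)^(d + 2) x^(k + 1) and u^d x^k at x = (1 + u^2) / (4u^2), that is, the terms
  that x^k contributes to P_(d + 1)(u) and Q_d(u).
\<close>

definition P_basis :: "nat \<Rightarrow> nat \<Rightarrow> complex poly" where
  "P_basis d k = smult (2 ^ (d - 2 * k)) ([:0, 1:] ^ (d - 2 * k) * [:1, 0, 1:] ^ Suc k)"

definition Q_basis :: "nat \<Rightarrow> nat \<Rightarrow> complex poly" where
  "Q_basis d k = smult ((1 / 4) ^ k) ([:0, 1:] ^ (d - 2 * k) * [:1, 0, 1:] ^ k)"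

text \<open>The operator sends u^e (1 + u^2)^j to 2j u^(e + 1) (1 + u^2)^j + e u^(e - 1) (1 +
  u^2)^(j + 1). For j = k + 1 the weights 2^e turn the factors 2j and e into k + 1 and 2e, the
  recurrence for \<open>r = 1\<close>.\<close>

lemma deriv_P_eq_gamma_sum: "deriv_P (Suc d) = gamma_sum 1 P_basis d"
proof (induction d)
  case 0
  then show ?case by (simp add: P_basis_def pderiv_pCons one_pCons)
next
  case (Suc d)
  let ?L = "\<lambda>p :: complex poly. [:1, 0, 1:] * pderiv p"
  have "?L (gamma_sum 1 P_basis d) = gamma_sum 1 P_basis (Suc d)"
  proof (rule gamma_sum_step)
    fix k assume "2 * k \<le> d"
    then obtain e where e: "d = 2 * k + e" using le_Suc_ex by blast
    have "poly (?L (P_basis d k)) x = poly (smult (of_int (1 * int k + 1)) (P_basis (Suc d) k)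
        + smult (of_int (2 * 1 * (int d - 2 * int k))) (P_basis (Suc d) (Suc k))) x" for x
      unfolding e P_basis_def poly_pderiv_simps
      by (cases e) (simp_all add: algebra_simps)
    then show "?L (P_basis d k) = smult (of_int (1 * int k + 1)) (P_basis (Suc d) k)
        + smult (of_int (2 * 1 * (int d - 2 * int k))) (P_basis (Suc d) (Suc k))"
      by (intro poly_eq_poly_eq_iff[THEN iffD1] ext)
  qed (simp_all only: pderiv_add pderiv_smult distrib_left mult_smult_right)
  with Suc show ?case by simp
qed

text \<open>The extra summand u p raises the factor 2k of u^(e + 1) (1 + u^2)^k to 2k + 1, and the
  weights (1 / 4)^k turn the factor e into 4e, the recurrence for \<open>r = 2\<close>.\<close>

lemma deriv_Q_eq_gamma_sum: "deriv_Q d = gamma_sum 2 Q_basis d"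
proof (induction d)
  case 0
  then show ?case by (simp add: Q_basis_def)
next
  case (Suc d)
  let ?L = "\<lambda>p :: complex poly. [:1, 0, 1:] * pderiv p + [:0, 1:] * p"
  have "?L (gamma_sum 2 Q_basis d) = gamma_sum 2 Q_basis (Suc d)"
  proof (rule gamma_sum_step)
    fix k assume "2 * k \<le> d"
    then obtain e where e: "d = 2 * k + e" using le_Suc_ex by blast
    \<comment> \<open>Both powers of 1 / 4 in the identity become integer multiples of one
      constant.\<close>
    define c :: complex where "c = (1 / 4) ^ Suc k"
    then have c: "(1 / 4) ^ Suc k = c" "(1 / 4) ^ k = 4 * c" by (simp_all add: c_def)
    have "poly (?L (Q_basis d k)) x = poly (smult (of_int (2 * int k + 1)) (Q_basis (Suc d) k)
        + smult (of_int (2 * 2 * (int d - 2 * int k))) (Q_basis (Suc d) (Suc k))) x" for x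
      unfolding e Q_basis_def poly_pderiv_simps c
      by (cases e; cases k) (simp_all add: algebra_simps)
    then show "?L (Q_basis d k) = smult (of_int (2 * int k + 1)) (Q_basis (Suc d) k)
        + smult (of_int (2 * 2 * (int d - 2 * int k))) (Q_basis (Suc d) (Suc k))"
      by (intro poly_eq_poly_eq_iff[THEN iffD1] ext)
  qed (simp_all add: pderiv_add pderiv_smult distrib_left smult_add_right)
  with Suc show ?case by simp
qed

section \<open>Insertion of an extreme letter\<close>

fun list_des :: "int list \<Rightarrow> nat" where
  "list_des (x # y # zs) = of_bool (x > y) + list_des (y # zs)"
| "list_des zs = 0"

text \<open>Passes from the recursion, suited to insertion, to the count over positions used by
  \<open>des\<close> and \<open>des_B\<close>.\<close>

lemma list_des_Cons_conv_sum:
  "list_des (x # xs) = (\<Sum>i<length xs. of_bool ((x # xs) ! i > xs ! i))"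
  by (induction xs arbitrary: x) (simp_all add: sum.lessThan_Suc_shift del: sum.lessThan_Suc)

text \<open>A largest letter leaves the number of descents unchanged exactly when it goes into a
  descent or to the end; every other gap gains one.\<close>

lemma sum_insert_max:
  assumes "\<forall>z \<in> set (y # w). z < m"
  shows "(\<Sum>i\<le>length w. monom 1 (list_des (y # take i w @ m # drop i w))) =
    smult (int (list_des (y # w)) + 1) (monom 1 (list_des (y # w)))
    + smult (int (length w) - int (list_des (y # w))) (monom 1 (Suc (list_des (y # w))))"
  using assms
proof (induction w arbitrary: y)
  case (Cons z w)
  \<comment> \<open>In the term i = 0, \<open>m\<close> separates \<open>y\<close> from
    \<open>z\<close> and starts a descent; in all others the comparison of \<open>y\<close> with
    \<open>z\<close> survives as a common factor.\<close>
  have "(\<Sum>i\<le>length (z # w). monom 1 (list_des (y # take i (z # w) @ m # drop i (z # w)))) =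
     monom 1 (Suc (list_des (z # w))) +
     monom 1 (of_bool (y > z)) * (\<Sum>i\<le>length w. monom (1::int) (list_des (z # take i w @ m # drop i w)))"
    using Cons.prems
    by (simp add: sum.atMost_Suc_shift sum_distrib_left mult_monom del: sum.atMost_Suc)
  also have "(\<Sum>i\<le>length w. monom (1::int) (list_des (z # take i w @ m # drop i w))) =
     smult (int (list_des (z # w)) + 1) (monom 1 (list_des (z # w)))
    + smult (int (length w) - int (list_des (z # w))) (monom 1 (Suc (list_des (z # w))))"
    using Cons by simp
  finally show ?case
    by (auto simp: mult_monom smult_monom add_monom algebra_simps)
qed (simp add: monom_altdef)

text \<open>A smallest letter leaves the number of descents unchanged exactly when it goes into a
  descent; at the end it now creates one.\<close>

lemma sum_insert_min:
  assumes "\<forall>z \<in> set (y # w). m < z"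
  shows "(\<Sum>i\<le>length w. monom 1 (list_des (y # take i w @ m # drop i w))) =
    smult (int (list_des (y # w))) (monom 1 (list_des (y # w)))
    + smult (int (length w) + 1 - int (list_des (y # w))) (monom 1 (Suc (list_des (y # w))))"
  using assms
proof (induction w arbitrary: y)
  case (Cons z w)
  have "(\<Sum>i\<le>length (z # w). monom 1 (list_des (y # take i (z # w) @ m # drop i (z # w)))) =
     monom 1 (Suc (list_des (z # w))) +
     monom 1 (of_bool (y > z)) * (\<Sum>i\<le>length w. monom (1::int) (list_des (z # take i w @ m # drop i w)))"
    using Cons.prems
    by (simp add: sum.atMost_Suc_shift sum_distrib_left mult_monom del: sum.atMost_Suc)
  also have "(\<Sum>i\<le>length w. monom (1::int) (list_des (z # take i w @ m # drop i w))) =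
     smult (int (list_des (z # w))) (monom 1 (list_des (z # w)))
    + smult (int (length w) + 1 - int (list_des (z # w))) (monom 1 (Suc (list_des (z # w))))"
    using Cons by simp
  finally show ?case
    by (auto simp: mult_monom smult_monom add_monom algebra_simps)
qed (simp add: monom_altdef)

text \<open>The coefficients count insertion places for a word of length n with k descents: k + 1
  and n - k for a largest letter (\<open>r = 1\<close>, d = n - 1), 2k + 1 and 2n + 1 - 2k for a
  largest and a smallest one together (\<open>r = 2\<close>, d = n).\<close>

lemma euler_op_monom:
  "euler_op r d (monom 1 k) =
     smult (r * int k + 1) (monom 1 k) + smult (r * d + 1 - r * int k) (monom 1 (Suc k))"
  by (cases k) (simp_all add: euler_op_def pderiv_monom poly_eq_poly_eq_iff[symmetric] fun_eq_iff
    poly_monom algebra_simps)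

text \<open>As \<open>m\<close> does not occur in \<open>w\<close>, its only occurrence in the
  result marks the place of insertion, and \<open>remove1\<close> undoes the insertion.\<close>

lemma bij_betw_insert:
  assumes "\<And>w. w \<in> L \<Longrightarrow> length w = n \<and> m \<notin> set w"
  shows "bij_betw (\<lambda>(w, i). take i w @ m # drop i w) (L \<times> {..n}) {v. m \<in> set v \<and> remove1 m v \<in> L}"
  unfolding bij_betw_def
proof
  show "inj_on (\<lambda>(w, i). take i w @ m # drop i w) (L \<times> {..n})"
  proof (rule inj_onI, clarify)
    fix w i w' i'
    assume *: "w \<in> L" "w' \<in> L" "i \<le> n" "i' \<le> n"
      and eq: "take i w @ m # drop i w = take i' w' @ m # drop i' w'"
    have "m \<notin> set (take i w)" "m \<notin> set (drop i w)"
      using assms[OF \<open>w \<in> L\<close>] by (auto dest: in_set_takeD in_set_dropD)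
    then have eqs: "take i w = take i' w'" "drop i w = drop i' w'"
      using eq by (auto simp: append_Cons_eq_iff)
    then have "w = w'" by (metis append_take_drop_id)
    moreover have "i = i'"
      using arg_cong[OF eqs(1), of length] * assms by (simp add: min_absorb2)
    ultimately show "w = w' \<and> i = i'" by simp
  qed
  show "(\<lambda>(w, i). take i w @ m # drop i w) ` (L \<times> {..n}) = {v. m \<in> set v \<and> remove1 m v \<in> L}"
  proof (intro equalityI subsetI)
    fix v assume "v \<in> (\<lambda>(w, i). take i w @ m # drop i w) ` (L \<times> {..n})"
    then obtain w i where "w \<in> L" and v: "v = take i w @ m # drop i w" by auto
    moreover have "m \<notin> set (take i w)"
      using assms[OF \<open>w \<in> L\<close>] by (auto dest: in_set_takeD)
    ultimately show "v \<in> {v. m \<in> set v \<and> remove1 m v \<in> L}"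
      by (simp add: remove1_append)
  next
    fix v assume v: "v \<in> {v. m \<in> set v \<and> remove1 m v \<in> L}"
    then obtain xs ys where xs: "v = xs @ m # ys" "m \<notin> set xs"
      using split_list_first by fast
    with v have L: "xs @ ys \<in> L" by (simp add: remove1_append)
    then have "(xs @ ys, length xs) \<in> L \<times> {..n}" using assms[OF L] by auto
    with xs(1) show "v \<in> (\<lambda>(w, i). take i w @ m # drop i w) ` (L \<times> {..n})"
      by (intro image_eqI[where x = "(xs @ ys, length xs)"]) auto
  qed
qed

lemma sum_insert:
  assumes "\<And>w. w \<in> L \<Longrightarrow> length w = n \<and> m \<notin> set w"
  shows "(\<Sum>v | m \<in> set v \<and> remove1 m v \<in> L. f v) = (\<Sum>w\<in>L. \<Sum>i\<le>n. f (take i w @ m # drop i w))"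
proof -
  have "(\<Sum>v | m \<in> set v \<and> remove1 m v \<in> L. f v) =
      (\<Sum>(w, i)\<in>L \<times> {..n}. f (take i w @ m # drop i w))"
    by (subst sum.reindex_bij_betw[OF bij_betw_insert[OF assms], symmetric])
       (auto simp: case_prod_unfold)
  then show ?thesis by (simp add: sum.cartesian_product)
qed


section \<open>Permutations as words\<close>

text \<open>Since n letters cover n values, none repeats. Letters are integers so that both types
  share \<open>list_des\<close>.\<close>

definition perm_words :: "nat \<Rightarrow> int list set" where
  "perm_words n = {w. length w = n \<and> set w = {1..int n}}"

text \<open>The window pi(1) ... pi(n), which determines a signed permutation by oddness; the
  absolute values are distinct because n of them cover n values.\<close>

definition signed_perm_words :: "nat \<Rightarrow> int list set" where
  "signed_perm_words n = {w. length w = n \<and> abs ` set w = {1..int n}}"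

lemma finite_signed_perm_words: "finite (signed_perm_words n)"
proof (rule finite_subset)
  show "signed_perm_words n \<subseteq> {w. set w \<subseteq> {- int n..int n} \<and> length w = n}"
  proof
    fix w assume "w \<in> signed_perm_words n"
    then have "length w = n" and *: "abs ` set w = {1..int n}"
      by (auto simp: signed_perm_words_def)
    moreover have "z \<in> {- int n..int n}" if "z \<in> set w" for z
    proof -
      have "\<bar>z\<bar> \<in> {1..int n}" using * that by blast
      then show ?thesis by auto
    qed
    ultimately show "w \<in> {w. set w \<subseteq> {- int n..int n} \<and> length w = n}" by blast
  qed
qed (simp add: finite_lists_length_eq)

lemma distinct_perm_words: "w \<in> perm_words n \<Longrightarrow> distinct w"
  by (auto simp: perm_words_def intro: card_distinct)

lemma distinct_abs_signed_perm_words: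
  assumes "w \<in> signed_perm_words n"
  shows "distinct (map abs w)"
proof (rule card_distinct)
  show "card (set (map abs w)) = length (map abs w)"
    using assms by (simp add: signed_perm_words_def)
qed

lemma set_eq_insert_remove1: "x \<in> set xs \<Longrightarrow> set xs = insert x (set (remove1 x xs))"
  by (induction xs) auto

lemma perm_words_Suc:
  "perm_words (Suc n) = {v. int (Suc n) \<in> set v \<and> remove1 (int (Suc n)) v \<in> perm_words n}"
    (is "_ = ?R")
proof (intro equalityI subsetI)
  fix v assume v: "v \<in> perm_words (Suc n)"
  then have len: "length v = Suc n" and set: "set v = {1..int (Suc n)}"
    unfolding perm_words_def by blast+
  have "set (remove1 (int (Suc n)) v) = {1..int (Suc n)} - {int (Suc n)}"
    using distinct_perm_words[OF v] by (simp only: set_remove1_eq set)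
  also have "\<dots> = {1..int n}" by auto
  finally show "v \<in> ?R"
    by (simp add: perm_words_def length_remove1 len set)
next
  fix v assume "v \<in> ?R"
  then have mem: "int (Suc n) \<in> set v" and len: "length (remove1 (int (Suc n)) v) = n"
    and set: "set (remove1 (int (Suc n)) v) = {1..int n}"
    unfolding perm_words_def by blast+
  from len mem have "length v - 1 = n" by (simp add: length_remove1)
  with length_pos_if_in_set[OF mem] have "length v = Suc n" by linarith
  moreover have "insert (int (Suc n)) {1..int n} = {1..int (Suc n)}" by auto
  then have "set v = {1..int (Suc n)}"
    using set_eq_insert_remove1[OF mem] unfolding set by (rule trans[rotated])
  ultimately show "v \<in> perm_words (Suc n)"
    unfolding perm_words_def by blast
qed

lemma abs_signed_perm_words: "w \<in> signed_perm_words n \<Longrightarrow> z \<in> set w \<Longrightarrow> \<bar>z\<bar> \<in> {1..int n}"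
  by (auto simp: signed_perm_words_def)

lemma signed_perm_words_insert_iff:
  assumes "\<bar>m\<bar> = int (Suc n)" "m \<in> set v"
  shows "v \<in> signed_perm_words (Suc n) \<longleftrightarrow> remove1 m v \<in> signed_perm_words n"
proof
  assume v: "v \<in> signed_perm_words (Suc n)"
  then have len: "length v = Suc n" and abs: "abs ` set v = {1..int (Suc n)}"
    by (auto simp: signed_perm_words_def)
  have "distinct v" and inj: "inj_on abs (set v)"
    using distinct_abs_signed_perm_words[OF v] by (auto simp: distinct_map)
  then have "set (remove1 m v) = set v - {m}" by (simp add: set_remove1_eq)
  \<comment> \<open>Because \<open>abs\<close> is injective on the letters, deleting
    \<open>m\<close> deletes its absolute value from the image.\<close>
  then have "abs ` set (remove1 m v) = abs ` set v - {\<bar>m\<bar>}"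
    using inj_on_image_set_diff[OF inj, of "set v" "{m}"] assms(2) by auto
  also have "\<dots> = {1..int n}" using abs assms(1) by auto
  finally show "remove1 m v \<in> signed_perm_words n"
    using len assms(2) by (simp add: signed_perm_words_def length_remove1)
next
  assume v: "remove1 m v \<in> signed_perm_words n"
  then have "length v - 1 = n"
    using assms(2) by (simp add: signed_perm_words_def length_remove1)
  with length_pos_if_in_set[OF assms(2)] have "length v = Suc n" by linarith
  moreover have "set v = insert m (set (remove1 m v))"
    using assms(2) by (rule set_eq_insert_remove1)
  then have "abs ` set v = insert (int (Suc n)) {1..int n}"
    using v assms(1) by (simp add: signed_perm_words_def)
  then have "abs ` set v = {1..int (Suc n)}" by auto
  ultimately show "v \<in> signed_perm_words (Suc n)"
    by (simp add: signed_perm_words_def)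
qed

lemma signed_perm_words_Suc:
  "signed_perm_words (Suc n) =
     {v. int (Suc n) \<in> set v \<and> remove1 (int (Suc n)) v \<in> signed_perm_words n} \<union>
     {v. - int (Suc n) \<in> set v \<and> remove1 (- int (Suc n)) v \<in> signed_perm_words n}"
  (is "_ = ?A \<union> ?B")
proof (intro equalityI subsetI)
  fix v assume v: "v \<in> signed_perm_words (Suc n)"
  then have "int (Suc n) \<in> abs ` set v" by (auto simp: signed_perm_words_def)
  then obtain m where m: "m \<in> set v" "\<bar>m\<bar> = int (Suc n)" by (metis imageE)
  with v have "remove1 m v \<in> signed_perm_words n" using signed_perm_words_insert_iff by blast
  moreover have "m = int (Suc n) \<or> m = - int (Suc n)" using m by linarith
  ultimately show "v \<in> ?A \<union> ?B" using m by blast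
next
  fix v assume "v \<in> ?A \<union> ?B"
  then show "v \<in> signed_perm_words (Suc n)"
    using signed_perm_words_insert_iff[of "int (Suc n)" n v]
      signed_perm_words_insert_iff[of "- int (Suc n)" n v] by auto
qed

text \<open>Deleting -(n + 1) would leave n + 1 in the word, whose letters have absolute value at
  most n.\<close>

lemma signed_perm_words_disjoint:
  "{v. int (Suc n) \<in> set v \<and> remove1 (int (Suc n)) v \<in> signed_perm_words n} \<inter>
   {v. - int (Suc n) \<in> set v \<and> remove1 (- int (Suc n)) v \<in> signed_perm_words n} = {}"
proof -
  have False if "int (Suc n) \<in> set v" "remove1 (- int (Suc n)) v \<in> signed_perm_words n" for v
  proof -
    have "int (Suc n) \<in> set (remove1 (- int (Suc n)) v)"
      using that(1) in_set_remove1[of "int (Suc n)" "- int (Suc n)" v] by simp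
    from abs_signed_perm_words[OF that(2) this] show False by simp
  qed
  then show ?thesis by blast
qed

section \<open>Descent polynomials of words\<close>

text \<open>The leading 0 stands for pi(0) in type B; before the positive letters of type A it adds
  no descent.\<close>

definition words_poly :: "int list set \<Rightarrow> int poly" where
  "words_poly W = (\<Sum>w\<in>W. monom 1 (list_des (0 # w)))"

lemma words_poly_perm_words_Suc:
  "words_poly (perm_words (Suc n)) = euler_op 1 (int n - 1) (words_poly (perm_words n))"
proof -
  have len: "length w = n" if "w \<in> perm_words n" for w
    using that by (simp add: perm_words_def)
  have "words_poly (perm_words (Suc n)) = (\<Sum>w\<in>perm_words n.
      \<Sum>i\<le>length w. monom 1 (list_des (0 # take i w @ int (Suc n) # drop i w)))"
    unfolding words_poly_def perm_words_Suc
    by (subst sum_insert[where n = n]) (auto simp: perm_words_def)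
  also have "\<dots> = (\<Sum>w\<in>perm_words n. euler_op 1 (int n - 1) (monom 1 (list_des (0 # w))))"
  proof (rule sum.cong[OF refl])
    fix w assume w: "w \<in> perm_words n"
    then have "\<forall>z\<in>set (0 # w). z < int (Suc n)" by (auto simp: perm_words_def)
    from sum_insert_max[OF this]
    show "(\<Sum>i\<le>length w. monom 1 (list_des (0 # take i w @ int (Suc n) # drop i w))) =
        euler_op 1 (int n - 1) (monom 1 (list_des (0 # w)))"
      using w by (simp add: euler_op_monom len algebra_simps)
  qed
  finally show ?thesis by (simp add: words_poly_def euler_op_sum)
qed

lemma words_poly_signed_perm_words_Suc:
  "words_poly (signed_perm_words (Suc n)) = euler_op 2 (int n) (words_poly (signed_perm_words n))"
proof -
  have len: "length w = n" if "w \<in> signed_perm_words n" for w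
    using that by (simp add: signed_perm_words_def)
  have notin: "length w = n \<and> int (Suc n) \<notin> set w" "length w = n \<and> - int (Suc n) \<notin> set w"
    if "w \<in> signed_perm_words n" for w
    using abs_signed_perm_words[OF that] len[OF that] by force+
  have "words_poly (signed_perm_words (Suc n)) =
      (\<Sum>w\<in>signed_perm_words n.
        \<Sum>i\<le>n. monom 1 (list_des (0 # take i w @ int (Suc n) # drop i w))) +
      (\<Sum>w\<in>signed_perm_words n.
        \<Sum>i\<le>n. monom 1 (list_des (0 # take i w @ (- int (Suc n)) # drop i w)))"
    using finite_signed_perm_words[of "Suc n"]
    unfolding words_poly_def signed_perm_words_Suc finite_Un
    by (simp only: sum.union_disjoint[OF _ _ signed_perm_words_disjoint]
        sum_insert[OF notin(1)] sum_insert[OF notin(2)])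
  also have "\<dots> = (\<Sum>w\<in>signed_perm_words n. euler_op 2 (int n) (monom 1 (list_des (0 # w))))"
  proof (subst sum.distrib[symmetric], rule sum.cong[OF refl])
    fix w assume w: "w \<in> signed_perm_words n"
    have "z < int (Suc n)" "- int (Suc n) < z" if "z \<in> set (0 # w)" for z
      using that abs_signed_perm_words[OF w, of z] by auto
    then have "\<forall>z\<in>set (0 # w). z < int (Suc n)" "\<forall>z\<in>set (0 # w). - int (Suc n) < z" by blast+
    from sum_insert_max[OF this(1)] sum_insert_min[OF this(2)]
    show "(\<Sum>i\<le>n. monom 1 (list_des (0 # take i w @ int (Suc n) # drop i w))) +
        (\<Sum>i\<le>n. monom 1 (list_des (0 # take i w @ (- int (Suc n)) # drop i w))) =
        euler_op 2 (int n) (monom 1 (list_des (0 # w)))"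
      unfolding len[OF w] by (simp add: euler_op_monom algebra_simps smult_monom add_monom)
  qed
  finally show ?thesis by (simp add: words_poly_def euler_op_sum)
qed

lemma gamma_sum_gamma_basis_Suc:
  "gamma_sum r gamma_basis (Suc d) = euler_op r (int d) (gamma_sum r gamma_basis d)"
  by (rule gamma_sum_step[symmetric])
     (simp_all only: euler_op_add euler_op_smult euler_op_gamma_basis of_int_eq_id id_apply)

text \<open>The shift reflects that A_(d + 1) has degree d; the base case is one insertion into the
  empty word.\<close>

lemma words_poly_perm_words: "words_poly (perm_words (Suc d)) = gamma_sum 1 gamma_basis d"
proof (induction d)
  case 0
  have "perm_words 0 = {[]}" by (auto simp: perm_words_def)
  then have "words_poly (perm_words 0) = 1" by (simp add: words_poly_def monom_altdef)
  then show ?case by (simp add: words_poly_perm_words_Suc euler_op_def gamma_basis_def one_pCons)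
next
  case (Suc d)
  then show ?case
    by (simp add: words_poly_perm_words_Suc[of "Suc d"] gamma_sum_gamma_basis_Suc)
qed

lemma words_poly_signed_perm_words: "words_poly (signed_perm_words n) = gamma_sum 2 gamma_basis n"
proof (induction n)
  case 0
  have "signed_perm_words 0 = {[]}" by (auto simp: signed_perm_words_def)
  then show ?case by (simp add: words_poly_def monom_altdef gamma_basis_def)
next
  case (Suc n)
  then show ?case
    by (simp add: words_poly_signed_perm_words_Suc gamma_sum_gamma_basis_Suc)
qed


section \<open>Bijections between permutations and words\<close>

lemma bij_betw_permutes_perm_words:
  "bij_betw (\<lambda>\<pi>. map (\<lambda>i. int (\<pi> (Suc i))) [0..<n]) {\<pi>. \<pi> permutes {1..n}} (perm_words n)"
  unfolding bij_betw_def
proof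
  show "inj_on (\<lambda>\<pi>. map (\<lambda>i. int (\<pi> (Suc i))) [0..<n]) {\<pi>. \<pi> permutes {1..n}}"
  proof (rule inj_onI, rule ext, unfold mem_Collect_eq)
    fix \<pi> \<sigma> i
    assume *: "\<pi> permutes {1..n}" "\<sigma> permutes {1..n}"
      and eq: "map (\<lambda>i. int (\<pi> (Suc i))) [0..<n] = map (\<lambda>i. int (\<sigma> (Suc i))) [0..<n]"
    show "\<pi> i = \<sigma> i"
    proof (cases "i \<in> {1..n}")
      case True
      then have "i - 1 \<in> set [0..<n]" "Suc (i - 1) = i" by auto
      with eq have "int (\<pi> (Suc (i - 1))) = int (\<sigma> (Suc (i - 1)))"
        unfolding map_eq_conv by blast
      with \<open>Suc (i - 1) = i\<close> show ?thesis by simp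
    next
      case False
      with * show ?thesis by (metis permutes_not_in)
    qed
  qed
  show "(\<lambda>\<pi>. map (\<lambda>i. int (\<pi> (Suc i))) [0..<n]) ` {\<pi>. \<pi> permutes {1..n}} = perm_words n"
  proof (intro equalityI subsetI)
    fix w assume "w \<in> (\<lambda>\<pi>. map (\<lambda>i. int (\<pi> (Suc i))) [0..<n]) ` {\<pi>. \<pi> permutes {1..n}}"
    then obtain \<pi> where \<pi>: "\<pi> permutes {1..n}" and w: "w = map (\<lambda>i. int (\<pi> (Suc i))) [0..<n]"
      by auto
    have "set w = int ` \<pi> ` Suc ` {0..<n}"
      by (simp only: w set_map set_upt image_image)
    also have "Suc ` {0..<n} = {1..n}" by auto
    also have "\<pi> ` {1..n} = {1..n}" by (rule permutes_image[OF \<pi>])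
    finally show "w \<in> perm_words n" by (simp add: perm_words_def w image_int_atLeastAtMost)
  next
    fix w assume w: "w \<in> perm_words n"
    then have len: "length w = n" and set: "set w = {1..int n}" by (auto simp: perm_words_def)
    \<comment> \<open>Word positions start at 0, arguments at 1; outside the range
      \<open>permutes\<close> demands the identity.\<close>
    define \<pi> where "\<pi> i = (if i \<in> {1..n} then nat (w ! (i - 1)) else i)" for i
    have nth: "int (\<pi> (Suc i)) = w ! i" "\<pi> (Suc i) \<in> {1..n}" if "i < n" for i
    proof -
      have "w ! i \<in> {1..int n}" using that len nth_mem[of i w] unfolding set by simp
      then show "int (\<pi> (Suc i)) = w ! i" "\<pi> (Suc i) \<in> {1..n}"
        using that by (auto simp: \<pi>_def)
    qed
    have "inj_on \<pi> {1..n}"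
    proof (rule inj_onI)
      fix i j assume ij: "i \<in> {1..n}" "j \<in> {1..n}" "\<pi> i = \<pi> j"
      then have "w ! (i - 1) = w ! (j - 1)"
        using nth(1)[of "i - 1"] nth(1)[of "j - 1"] by auto
      moreover have "i - 1 < length w" "j - 1 < length w" using ij len by auto
      ultimately have "i - 1 = j - 1"
        using nth_eq_iff_index_eq[OF distinct_perm_words[OF w]] by blast
      then show "i = j" using ij by auto
    qed
    moreover have "\<pi> ` {1..n} \<subseteq> {1..n}"
    proof (rule image_subsetI)
      fix i assume "i \<in> {1..n}"
      then show "\<pi> i \<in> {1..n}" using nth(2)[of "i - 1"] by auto
    qed
    ultimately have "bij_betw \<pi> {1..n} {1..n}"
      by (simp add: bij_betw_def endo_inj_surj)
    then have "\<pi> permutes {1..n}"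
      by (rule bij_imp_permutes) (auto simp: \<pi>_def)
    moreover have "w = map (\<lambda>i. int (\<pi> (Suc i))) [0..<n]"
      by (rule nth_equalityI) (auto simp: len nth)
    ultimately show "w \<in> (\<lambda>\<pi>. map (\<lambda>i. int (\<pi> (Suc i))) [0..<n]) ` {\<pi>. \<pi> permutes {1..n}}"
      by blast
  qed
qed

lemma list_des_perm_word:
  "list_des (0 # map (\<lambda>i. int (\<pi> (Suc i))) [0..<n]) = des n \<pi>"
proof -
  have "list_des (0 # map (\<lambda>i. int (\<pi> (Suc i))) [0..<n]) =
      (\<Sum>i<n. of_bool (0 < i \<and> \<pi> i > \<pi> (Suc i)))"
    unfolding list_des_Cons_conv_sum by (intro sum.cong) (auto simp: nth_Cons split: nat.split)
  also have "\<dots> = (\<Sum>i\<in>{i \<in> {1..<n}. \<pi> i > \<pi> (i + 1)}. 1)"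
    by (rule sum.mono_neutral_cong_right) auto
  finally show ?thesis by (simp add: des_def)
qed

lemma eulerian_A_eq_words_poly: "eulerian_A n = words_poly (perm_words n)"
  unfolding eulerian_A_def words_poly_def
  by (subst sum.reindex_bij_betw[OF bij_betw_permutes_perm_words, symmetric])
     (simp add: list_des_perm_word)

lemma bij_betw_signed_perms_signed_perm_words:
  "bij_betw (\<lambda>\<pi>. map (\<lambda>i. \<pi> (int (Suc i))) [0..<n]) (signed_perms n) (signed_perm_words n)"
  unfolding bij_betw_def
proof
  let ?S = "{- int n..int n} - {0}"
  show "inj_on (\<lambda>\<pi>. map (\<lambda>i. \<pi> (int (Suc i))) [0..<n]) (signed_perms n)"
  proof (rule inj_onI, rule ext)
    fix \<pi> \<sigma> i
    assume \<pi>: "\<pi> \<in> signed_perms n" and \<sigma>: "\<sigma> \<in> signed_perms n"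
      and eq: "map (\<lambda>i. \<pi> (int (Suc i))) [0..<n] = map (\<lambda>i. \<sigma> (int (Suc i))) [0..<n]"
    have pos: "\<pi> i = \<sigma> i" if "i \<in> {1..int n}" for i
    proof -
      have "nat i - 1 \<in> set [0..<n]" "int (Suc (nat i - 1)) = i" using that by auto
      with eq have "\<pi> (int (Suc (nat i - 1))) = \<sigma> (int (Suc (nat i - 1)))"
        unfolding map_eq_conv by blast
      with \<open>int (Suc (nat i - 1)) = i\<close> show ?thesis by simp
    qed
    consider "i \<in> {1..int n}" | "- i \<in> {1..int n}" | "i \<notin> ?S" by force
    then show "\<pi> i = \<sigma> i"
    proof cases
      case 1
      then show ?thesis by (rule pos)
    next
      case 2
      then have "- i \<in> ?S" by auto
      with \<pi> \<sigma> have "\<pi> (- (- i)) = - \<pi> (- i)" "\<sigma> (- (- i)) = - \<sigma> (- i)"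
        unfolding signed_perms_def by blast+
      with pos[OF 2] show ?thesis by simp
    next
      case 3
      with \<pi> \<sigma> show ?thesis unfolding signed_perms_def mem_Collect_eq by (metis permutes_not_in)
    qed
  qed
  show "(\<lambda>\<pi>. map (\<lambda>i. \<pi> (int (Suc i))) [0..<n]) ` signed_perms n = signed_perm_words n"
  proof (intro equalityI subsetI)
    fix w assume "w \<in> (\<lambda>\<pi>. map (\<lambda>i. \<pi> (int (Suc i))) [0..<n]) ` signed_perms n"
    then obtain \<pi> where \<pi>: "\<pi> permutes ?S" and odd: "\<And>i. i \<in> ?S \<Longrightarrow> \<pi> (- i) = - \<pi> i"
      and w: "w = map (\<lambda>i. \<pi> (int (Suc i))) [0..<n]"
      by (auto simp: signed_perms_def)
    have mem: "\<pi> i \<in> ?S \<longleftrightarrow> i \<in> ?S" for i by (rule permutes_in_image[OF \<pi>])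
    have "abs ` set w = {1..int n}"
    proof (intro equalityI subsetI)
      fix z assume "z \<in> abs ` set w"
      then obtain i where i: "i < n" "z = \<bar>\<pi> (int (Suc i))\<bar>" by (auto simp: w)
      then have "\<pi> (int (Suc i)) \<in> ?S" unfolding mem by auto
      then show "z \<in> {1..int n}" using i by auto
    next
      fix z assume z: "z \<in> {1..int n}"
      then have "z \<in> \<pi> ` ?S" using permutes_image[OF \<pi>] by auto
      then obtain j where j: "j \<in> ?S" "z = \<pi> j" by blast
      \<comment> \<open>If the preimage \<open>j\<close> of \<open>z\<close> is negative, oddness
        gives -z as the value at its absolute value.\<close>
      have abs: "z = \<bar>\<pi> \<bar>j\<bar>\<bar>"
        using z j odd[OF j(1)] by (cases "j < 0") auto
      have "nat \<bar>j\<bar> - 1 < n" "int (Suc (nat \<bar>j\<bar> - 1)) = \<bar>j\<bar>" using j(1) by auto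
      then have "\<pi> \<bar>j\<bar> \<in> set w"
        unfolding w set_map by (metis atLeastLessThan_iff imageI set_upt zero_le)
      with abs show "z \<in> abs ` set w" by blast
    qed
    then show "w \<in> signed_perm_words n" by (simp add: signed_perm_words_def w)
  next
    fix w assume w: "w \<in> signed_perm_words n"
    then have len: "length w = n" by (simp add: signed_perm_words_def)
    \<comment> \<open>The factor \<open>sgn i\<close> extends the window to an odd function.\<close>
    define \<pi> where "\<pi> i = (if i \<in> ?S then sgn i * w ! (nat \<bar>i\<bar> - 1) else i)" for i
    have abs_nth: "\<bar>\<pi> i\<bar> = \<bar>w ! (nat \<bar>i\<bar> - 1)\<bar>" and bounds: "\<bar>\<pi> i\<bar> \<in> {1..int n}" if "i \<in> ?S" for i
    proof -
      show eq: "\<bar>\<pi> i\<bar> = \<bar>w ! (nat \<bar>i\<bar> - 1)\<bar>" using that by (simp add: \<pi>_def abs_mult)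
      have "nat \<bar>i\<bar> - 1 < n" using that by auto
      then show "\<bar>\<pi> i\<bar> \<in> {1..int n}"
        unfolding eq using len by (intro abs_signed_perm_words[OF w]) auto
    qed
    have odd: "\<pi> (- i) = - \<pi> i" if "i \<in> ?S" for i
      using that by (auto simp: \<pi>_def sgn_minus)
    have "inj_on \<pi> ?S"
    proof (rule inj_onI)
      fix i j assume ij: "i \<in> ?S" "j \<in> ?S" "\<pi> i = \<pi> j"
      have bnd: "nat \<bar>i\<bar> - 1 < length (map abs w)" "nat \<bar>j\<bar> - 1 < length (map abs w)"
        using ij(1,2) by (auto simp: len)
      moreover have "map abs w ! (nat \<bar>i\<bar> - 1) = map abs w ! (nat \<bar>j\<bar> - 1)"
        using abs_nth[OF ij(1)] abs_nth[OF ij(2)] ij(3) bnd by simp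
      ultimately have "nat \<bar>i\<bar> - 1 = nat \<bar>j\<bar> - 1"
        using nth_eq_iff_index_eq[OF distinct_abs_signed_perm_words[OF w]] by blast
      then have "\<bar>i\<bar> = \<bar>j\<bar>" using ij(1,2) by auto
      \<comment> \<open>Otherwise oddness would give \<pi> j = - \<pi> j, hence the excluded value
        0.\<close>
      moreover have "i \<noteq> - j"
        using ij(3) odd[OF ij(2)] bounds[OF ij(2)] by auto
      ultimately show "i = j" by linarith
    qed
    moreover have "\<pi> ` ?S \<subseteq> ?S"
      using bounds by fastforce
    ultimately have "bij_betw \<pi> ?S ?S"
      by (simp add: bij_betw_def endo_inj_surj)
    then have "\<pi> permutes ?S"
      by (rule bij_imp_permutes) (auto simp: \<pi>_def)
    with odd have "\<pi> \<in> signed_perms n" by (simp add: signed_perms_def)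
    moreover have "w = map (\<lambda>i. \<pi> (int (Suc i))) [0..<n]"
      by (rule nth_equalityI) (auto simp: len \<pi>_def nat_add_distrib)
    ultimately show "w \<in> (\<lambda>\<pi>. map (\<lambda>i. \<pi> (int (Suc i))) [0..<n]) ` signed_perms n"
      by blast
  qed
qed

lemma list_des_signed_perm_word:
  assumes "\<pi> 0 = 0"
  shows "list_des (0 # map (\<lambda>i. \<pi> (int (Suc i))) [0..<n]) = des_B n \<pi>"
proof -
  have "list_des (0 # map (\<lambda>i. \<pi> (int (Suc i))) [0..<n]) =
      (\<Sum>i<n. of_bool (\<pi> (int i) > \<pi> (int i + 1)))"
    unfolding list_des_Cons_conv_sum
    by (intro sum.cong) (auto simp: nth_Cons assms add.commute split: nat.split)
  also have "\<dots> = card {i \<in> {..<n}. \<pi> (int i) > \<pi> (int i + 1)}"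
    by (simp add: Int_def)
  also have "\<dots> = card (int ` {i \<in> {..<n}. \<pi> (int i) > \<pi> (int i + 1)})"
    by (simp add: card_image)
  also have "int ` {i \<in> {..<n}. \<pi> (int i) > \<pi> (int i + 1)} = {i \<in> {0..<int n}. \<pi> i > \<pi> (i + 1)}"
  proof (intro equalityI subsetI)
    fix i assume "i \<in> {i \<in> {0..<int n}. \<pi> i > \<pi> (i + 1)}"
    then show "i \<in> int ` {i \<in> {..<n}. \<pi> (int i) > \<pi> (int i + 1)}"
      by (intro image_eqI[of _ _ "nat i"]) auto
  qed auto
  finally show ?thesis by (simp add: des_B_def)
qed

lemma eulerian_B_eq_words_poly: "eulerian_B n = words_poly (signed_perm_words n)"
proof -
  \<comment> \<open>0 lies outside the permuted set, so it is fixed.\<close>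
  have "\<pi> 0 = 0" if "\<pi> \<in> signed_perms n" for \<pi>
    using that unfolding signed_perms_def by (auto intro: permutes_not_in)
  then show ?thesis
    unfolding eulerian_B_def words_poly_def
    by (subst sum.reindex_bij_betw[OF bij_betw_signed_perms_signed_perm_words, symmetric])
       (simp add: list_des_signed_perm_word del: of_nat_Suc)
qed

section \<open>Comparison of the two sides\<close>

lemma a_coeff_eq_gamma_rec: "a_coeff (Suc d) = gamma_rec 1 d"
  by (simp add: a_coeff_def eulerian_A_eq_words_poly words_poly_perm_words gamma_coeffs_gamma_sum)

lemma b_coeff_eq_gamma_rec: "b_coeff n = gamma_rec 2 n"
  by (simp add: b_coeff_def eulerian_B_eq_words_poly words_poly_signed_perm_words
      gamma_coeffs_gamma_sum)

theorem theorem5: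
  fixes n :: nat and x s :: complex
  assumes "n \<ge> 1" and "x \<noteq> 0" and "x \<noteq> 1 / 4"
    and "s ^ 2 = 4 * x - 1"
  shows "a_fun n x = (1 / x) * (s / 2) ^ (n + 1) * poly (deriv_P n) (1 / s)
       \<and> b_fun n x = s ^ n * poly (deriv_Q n) (1 / s)"
proof
  have "s \<noteq> 0" using assms(3,4) by (auto simp: field_simps)
  \<comment> \<open>The value of 1 + u^2 at u = 1 / s, written as a product to match the evaluation
    of \<open>[:1, 0, 1:]\<close>.\<close>
  then have quad: "1 + (1 / s) * (1 / s) = 4 * x / s ^ 2"
    using assms(4) by (simp add: field_simps power2_eq_square)
  obtain d where n: "n = Suc d" using assms(1) by (cases n) auto
  \<comment> \<open>Each basis element contributes exactly x^k: the powers of 2 / s add up to e +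
    2(k + 1) = n + 1 and cancel the prefactor.\<close>
  have "(1 / x) * (s / 2) ^ (n + 1) * poly (P_basis d k) (1 / s) = x ^ k" if "k \<le> d div 2" for k
  proof -
    have "2 * k \<le> d" using that by linarith
    then obtain e where e: "d = 2 * k + e" using le_Suc_ex by blast
    have "poly (P_basis d k) (1 / s) = 2 ^ e * (1 / s) ^ e * (4 * x / s ^ 2) ^ Suc k"
      using quad by (simp add: P_basis_def e del: power_Suc)
    also have "(4 * x / s ^ 2) ^ Suc k = x ^ Suc k * (2 / s) ^ (2 * Suc k)"
      unfolding power_mult power_mult_distrib[symmetric] by (simp add: power_divide)
    finally have "poly (P_basis d k) (1 / s) = x ^ Suc k * (2 / s) ^ (n + 1)"
      by (simp add: n e power_add power_divide mult_ac)
    then show ?thesis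
      using \<open>s \<noteq> 0\<close> assms(2) by (simp add: power_divide)
  qed
  then show "a_fun n x = (1 / x) * (s / 2) ^ (n + 1) * poly (deriv_P n) (1 / s)"
    unfolding n deriv_P_eq_gamma_sum a_fun_def gamma_sum_def a_coeff_eq_gamma_rec
    by (auto simp: poly_sum sum_distrib_left mult.left_commute[of _ "of_int _"] intro!: sum.cong
        simp del: power_Suc)
  \<comment> \<open>Here (1 / 4)^k cancels the 4 in 1 + u^2 = 4x / s^2, and the powers of 1 / s add
    up to e + 2k = n.\<close>
  have "s ^ n * poly (Q_basis n k) (1 / s) = x ^ k" if "k \<le> n div 2" for k
  proof -
    have "2 * k \<le> n" using that by linarith
    then obtain e where e: "n = 2 * k + e" using le_Suc_ex by blast
    have "poly (Q_basis n k) (1 / s) = (1 / 4) ^ k * (1 / s) ^ e * (4 * x / s ^ 2) ^ k"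
      using quad by (simp add: Q_basis_def e)
    then show ?thesis
      using \<open>s \<noteq> 0\<close> by (simp add: e power_add power_mult power_divide power_mult_distrib)
  qed
  then show "b_fun n x = s ^ n * poly (deriv_Q n) (1 / s)"
    unfolding deriv_Q_eq_gamma_sum b_fun_def gamma_sum_def b_coeff_eq_gamma_rec
    by (auto simp: poly_sum sum_distrib_left mult.left_commute[of _ "of_int _"] intro!: sum.cong)
qed

end
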